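(* Let $\mathbb{C}$ be a regular unital category with binary coproducts, comonadic covers $(P,\delta,\varepsilon)$ and a natural imaginary splitting $t$. Suppose that the natural addition $(\mu^X\colon X\times X\dashrightarrow X)_{X\in\mathbb{C}}$ is associative. Then intrinsic Schreier split extensions are stable under composition: if $f\colon X\to Y$ with section $s\colon Y\to X$ and $g\colon Y\to Z$ with section $v\colon Z\to Y$ are intrinsic Schreier split epimorphisms, then $gf\colon X\to Z$ with section $sv\colon Z\to X$ is an intrinsic Schreier split epimorphism.
   Context: Setting. A pointed finitely complete category is unital when for all objects $A,B$ the pair $\langle 1_A,0\rangle\colon A\to A\times B$, $\langle 0,1_B\rangle\colon B\to A\times B$ is jointly extremal-epimorphic. "Comonadic covers" means a comonad $(P,\delta,\varepsilon)$ on $\mathbb{C}$ such that every $\varepsilon_X\colon P(X)\to X$ is a regular epimorphism. A natural imaginary splitting is a natural transformation with components $t_{A,B}\colon P(A\times B)\to A+B$ such that $r_{A,B}t_{A,B}=\varepsilon_{A\times B}$, where $r_{A,B}\colon A+B\to A\times B$ is the canonical comparison morphism (with $\pi_A r_{A,B}=(1_A\;0)$ and $\pi_B r_{A,B}=(0\;1_B)$). Imaginary morphisms. An imaginary morphism $a\colon X\dashrightarrow Y$ is a morphism $a\colon P(X)\to Y$ in $\mathbb{C}$, i.e. a morphism of the Kleisli category of $P$; composition of $a\colon A\dashrightarrow B$ and $b\colon B\dashrightarrow C$ is $b\circ a=b\,P(a)\,\delta_A$. A real morphism $f\colon X\to Y$ of $\mathbb{C}$ is viewed as $\overline{f}=f\varepsilon_X\colon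 X\dashrightarrow Y$; for real $v$, $u$ one writes $v\circ a=va\;(=\overline{v}\circ a)$ and $a\circ u=aP(u)\;(=a\circ\overline{u})$. Finite products of $\mathbb{C}$ are also products for imaginary morphisms: $\langle a,b\rangle$ is the usual pairing in $\mathbb{C}$, and $a\times b=\langle a\circ\pi_1,b\circ\pi_2\rangle$. Imaginary addition: $\mu^X\colon X\times X\dashrightarrow X$ is $\mu^X=(1_X\;1_X)\,t_{X,X}\colon P(X\times X)\to X+X\to X$. The natural addition is associative when $\mu^X\circ(\mu^X\times\overline{1_X})=\mu^X\circ(\overline{1_X}\times\mu^X)$ as imaginary morphisms $X\times X\times X\dashrightarrow X$ for every object $X$. Intrinsic Schreier split epimorphism (also called, together with its kernel, intrinsic Schreier split extension): a split epimorphism $f\colon X\to Y$ with chosen section $s$ and kernel $k\colon K\to X$ for which there is an imaginary morphism $q\colon X\dashrightarrow K$ with $\mu^X\circ\langle k\circ q,\overline{sf}\rangle=\overline{1_X}$ and $q\circ\mu^X\circ(k\times s)=\overline{\pi_K}$, where $\pi_K\colon K\times Y\to K$ is the projection. *)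

theory Defs
  imports Main
begin

section \<open>Categories and limits\<close>

text \<open>Composition is written in applicative order and is only constrained on composable
  pairs; every notion below therefore carries explicit domain and codomain conditions.\<close>

record ('o, 'a) cat =
  Ob :: "'o set"
  Ar :: "'a set"
  src :: "'a \<Rightarrow> 'o"
  tgt :: "'a \<Rightarrow> 'o"
  idn :: "'o \<Rightarrow> 'a"
  cmp :: "'a \<Rightarrow> 'a \<Rightarrow> 'a" (infixr "\<cdot>\<index>" 75)

definition hom :: "('o, 'a, 'e) cat_scheme \<Rightarrow> 'o \<Rightarrow> 'o \<Rightarrow> 'a set" where
  "hom C A B = {f \<in> Ar C. src C f = A \<and> tgt C f = B}"

locale category =
  fixes C :: "('o, 'a, 'e) cat_scheme" (structure)
  assumes src_Ob: "f \<in> Ar C \<Longrightarrow> src C f \<in> Ob C"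
    and tgt_Ob: "f \<in> Ar C \<Longrightarrow> tgt C f \<in> Ob C"
    and idn_hom: "A \<in> Ob C \<Longrightarrow> idn C A \<in> hom C A A"
    and cmp_hom: "\<lbrakk>f \<in> hom C A B; g \<in> hom C B D\<rbrakk> \<Longrightarrow> g \<cdot> f \<in> hom C A D"
    and cmp_idn_left: "f \<in> hom C A B \<Longrightarrow> idn C B \<cdot> f = f"
    and cmp_idn_right: "f \<in> hom C A B \<Longrightarrow> f \<cdot> idn C A = f"
    and cmp_assoc: "\<lbrakk>f \<in> hom C A B; g \<in> hom C B D; h \<in> hom C D E\<rbrakk>
      \<Longrightarrow> (h \<cdot> g) \<cdot> f = h \<cdot> (g \<cdot> f)"

definition is_mono :: "('o, 'a, 'e) cat_scheme \<Rightarrow> 'a \<Rightarrow> bool" where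
  "is_mono C m \<longleftrightarrow> m \<in> Ar C \<and>
    (\<forall>V. \<forall>x \<in> hom C V (src C m). \<forall>y \<in> hom C V (src C m).
      m \<cdot>\<^bsub>C\<^esub> x = m \<cdot>\<^bsub>C\<^esub> y \<longrightarrow> x = y)"

definition is_iso :: "('o, 'a, 'e) cat_scheme \<Rightarrow> 'a \<Rightarrow> bool" where
  "is_iso C m \<longleftrightarrow> m \<in> Ar C \<and>
    (\<exists>n \<in> hom C (tgt C m) (src C m).
      n \<cdot>\<^bsub>C\<^esub> m = idn C (src C m) \<and> m \<cdot>\<^bsub>C\<^esub> n = idn C (tgt C m))"

definition is_terminal :: "('o, 'a, 'e) cat_scheme \<Rightarrow> 'o \<Rightarrow> bool" where
  "is_terminal C T \<longleftrightarrow> T \<in> Ob C \<and> (\<forall>A \<in> Ob C. \<exists>!f. f \<in> hom C A T)"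

definition is_initial :: "('o, 'a, 'e) cat_scheme \<Rightarrow> 'o \<Rightarrow> bool" where
  "is_initial C I \<longleftrightarrow> I \<in> Ob C \<and> (\<forall>A \<in> Ob C. \<exists>!f. f \<in> hom C I A)"

definition is_product ::
  "('o, 'a, 'e) cat_scheme \<Rightarrow> 'o \<Rightarrow> 'o \<Rightarrow> 'o \<Rightarrow> 'a \<Rightarrow> 'a \<Rightarrow> bool" where
  "is_product C A B W p q \<longleftrightarrow> p \<in> hom C W A \<and> q \<in> hom C W B \<and>
    (\<forall>V. \<forall>x \<in> hom C V A. \<forall>y \<in> hom C V B.
      \<exists>!h. h \<in> hom C V W \<and> p \<cdot>\<^bsub>C\<^esub> h = x \<and> q \<cdot>\<^bsub>C\<^esub> h = y)"

definition is_coproduct ::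
  "('o, 'a, 'e) cat_scheme \<Rightarrow> 'o \<Rightarrow> 'o \<Rightarrow> 'o \<Rightarrow> 'a \<Rightarrow> 'a \<Rightarrow> bool" where
  "is_coproduct C A B W i j \<longleftrightarrow> i \<in> hom C A W \<and> j \<in> hom C B W \<and>
    (\<forall>V. \<forall>x \<in> hom C A V. \<forall>y \<in> hom C B V.
      \<exists>!h. h \<in> hom C W V \<and> h \<cdot>\<^bsub>C\<^esub> i = x \<and> h \<cdot>\<^bsub>C\<^esub> j = y)"

definition is_equalizer ::
  "('o, 'a, 'e) cat_scheme \<Rightarrow> 'a \<Rightarrow> 'a \<Rightarrow> 'o \<Rightarrow> 'a \<Rightarrow> bool" where
  "is_equalizer C f g E e \<longleftrightarrow> (\<exists>A B. f \<in> hom C A B \<and> g \<in> hom C A B \<and> e \<in> hom C E A \<and>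
    f \<cdot>\<^bsub>C\<^esub> e = g \<cdot>\<^bsub>C\<^esub> e \<and>
    (\<forall>V. \<forall>x \<in> hom C V A. f \<cdot>\<^bsub>C\<^esub> x = g \<cdot>\<^bsub>C\<^esub> x \<longrightarrow>
      (\<exists>!h. h \<in> hom C V E \<and> e \<cdot>\<^bsub>C\<^esub> h = x)))"

definition is_coequalizer ::
  "('o, 'a, 'e) cat_scheme \<Rightarrow> 'a \<Rightarrow> 'a \<Rightarrow> 'o \<Rightarrow> 'a \<Rightarrow> bool" where
  "is_coequalizer C f g Q e \<longleftrightarrow> (\<exists>A B. f \<in> hom C A B \<and> g \<in> hom C A B \<and> e \<in> hom C B Q \<and>
    e \<cdot>\<^bsub>C\<^esub> f = e \<cdot>\<^bsub>C\<^esub> g \<and>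
    (\<forall>V. \<forall>x \<in> hom C B V. x \<cdot>\<^bsub>C\<^esub> f = x \<cdot>\<^bsub>C\<^esub> g \<longrightarrow>
      (\<exists>!h. h \<in> hom C Q V \<and> h \<cdot>\<^bsub>C\<^esub> e = x)))"

definition is_pullback ::
  "('o, 'a, 'e) cat_scheme \<Rightarrow> 'a \<Rightarrow> 'a \<Rightarrow> 'o \<Rightarrow> 'a \<Rightarrow> 'a \<Rightarrow> bool" where
  "is_pullback C f g W p q \<longleftrightarrow> (\<exists>A B D. f \<in> hom C A D \<and> g \<in> hom C B D \<and>
    p \<in> hom C W A \<and> q \<in> hom C W B \<and> f \<cdot>\<^bsub>C\<^esub> p = g \<cdot>\<^bsub>C\<^esub> q \<and>
    (\<forall>V. \<forall>x \<in> hom C V A. \<forall>y \<in> hom C V B. f \<cdot>\<^bsub>C\<^esub> x = g \<cdot>\<^bsub>C\<^esub> y \<longrightarrow>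
      (\<exists>!h. h \<in> hom C V W \<and> p \<cdot>\<^bsub>C\<^esub> h = x \<and> q \<cdot>\<^bsub>C\<^esub> h = y)))"

definition is_regular_epi :: "('o, 'a, 'e) cat_scheme \<Rightarrow> 'a \<Rightarrow> bool" where
  "is_regular_epi C e \<longleftrightarrow> (\<exists>f g. is_coequalizer C f g (tgt C e) e)"

definition jointly_extremal_epi :: "('o, 'a, 'e) cat_scheme \<Rightarrow> 'a \<Rightarrow> 'a \<Rightarrow> bool" where
  "jointly_extremal_epi C f g \<longleftrightarrow> f \<in> Ar C \<and> g \<in> Ar C \<and> tgt C f = tgt C g \<and>
    (\<forall>m. is_mono C m \<and>
      (\<exists>x \<in> hom C (src C f) (src C m). m \<cdot>\<^bsub>C\<^esub> x = f) \<and>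
      (\<exists>y \<in> hom C (src C g) (src C m). m \<cdot>\<^bsub>C\<^esub> y = g) \<and>
      tgt C m = tgt C f \<longrightarrow> is_iso C m)"

locale finitely_complete_category = category C
  for C :: "('o, 'a, 'e) cat_scheme" (structure) +
  assumes terminal_ex: "\<exists>T. is_terminal C T"
    and product_ex: "\<lbrakk>A \<in> Ob C; B \<in> Ob C\<rbrakk> \<Longrightarrow> \<exists>W p q. is_product C A B W p q"
    and equalizer_ex: "\<lbrakk>f \<in> hom C A B; g \<in> hom C A B\<rbrakk> \<Longrightarrow> \<exists>E e. is_equalizer C f g E e"

text \<open>A kernel pair of \<open>f\<close> is a pullback of \<open>f\<close> along itself.\<close>

locale regular_category = finitely_complete_category C
  for C :: "('o, 'a, 'e) cat_scheme" (structure) +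
  assumes kernel_pair_coequalizer_ex:
      "is_pullback C f f W p q \<Longrightarrow> \<exists>Q e. is_coequalizer C p q Q e"
    and regular_epi_pullback_stable:
      "\<lbrakk>is_regular_epi C e; is_pullback C f e W p q\<rbrakk> \<Longrightarrow> is_regular_epi C p"

section \<open>Unital categories\<close>

text \<open>The zero object and the binary products are chosen, but arbitrarily.\<close>

record ('o, 'a) pointed_cat = "('o, 'a) cat" +
  zer :: "'o"
  prd :: "'o \<Rightarrow> 'o \<Rightarrow> 'o"
  prj1 :: "'o \<Rightarrow> 'o \<Rightarrow> 'a"
  prj2 :: "'o \<Rightarrow> 'o \<Rightarrow> 'a"

definition zero_arr :: "('o, 'a, 'e) pointed_cat_scheme \<Rightarrow> 'o \<Rightarrow> 'o \<Rightarrow> 'a" where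
  "zero_arr C A B =
    (THE g. g \<in> hom C (zer C) B) \<cdot>\<^bsub>C\<^esub> (THE f. f \<in> hom C A (zer C))"

definition pair :: "('o, 'a, 'e) pointed_cat_scheme \<Rightarrow> 'a \<Rightarrow> 'a \<Rightarrow> 'a" where
  "pair C f g = (THE h. h \<in> hom C (src C f) (prd C (tgt C f) (tgt C g)) \<and>
    prj1 C (tgt C f) (tgt C g) \<cdot>\<^bsub>C\<^esub> h = f \<and> prj2 C (tgt C f) (tgt C g) \<cdot>\<^bsub>C\<^esub> h = g)"

definition prod_arr :: "('o, 'a, 'e) pointed_cat_scheme \<Rightarrow> 'a \<Rightarrow> 'a \<Rightarrow> 'a" where
  "prod_arr C f g = pair C (f \<cdot>\<^bsub>C\<^esub> prj1 C (src C f) (src C g))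
                           (g \<cdot>\<^bsub>C\<^esub> prj2 C (src C f) (src C g))"

text \<open>\<open>(X \<times> Y) \<times> Z \<rightarrow> X \<times> (Y \<times> Z)\<close>\<close>

definition prod_assoc :: "('o, 'a, 'e) pointed_cat_scheme \<Rightarrow> 'o \<Rightarrow> 'o \<Rightarrow> 'o \<Rightarrow> 'a" where
  "prod_assoc C X Y Z =
    pair C (prj1 C X Y \<cdot>\<^bsub>C\<^esub> prj1 C (prd C X Y) Z)
      (pair C (prj2 C X Y \<cdot>\<^bsub>C\<^esub> prj1 C (prd C X Y) Z) (prj2 C (prd C X Y) Z))"

definition is_kernel ::
  "('o, 'a, 'e) pointed_cat_scheme \<Rightarrow> 'a \<Rightarrow> 'o \<Rightarrow> 'a \<Rightarrow> bool" where
  "is_kernel C f K k \<longleftrightarrow> is_equalizer C f (zero_arr C (src C f) (tgt C f)) K k"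

locale unital_category = finitely_complete_category C
  for C :: "('o, 'a, 'e) pointed_cat_scheme" (structure) +
  assumes zer_terminal: "is_terminal C (zer C)"
    and zer_initial: "is_initial C (zer C)"
    and prd_product: "\<lbrakk>A \<in> Ob C; B \<in> Ob C\<rbrakk>
      \<Longrightarrow> is_product C A B (prd C A B) (prj1 C A B) (prj2 C A B)"
    and unital: "\<lbrakk>A \<in> Ob C; B \<in> Ob C\<rbrakk>
      \<Longrightarrow> jointly_extremal_epi C (pair C (idn C A) (zero_arr C A B))
            (pair C (zero_arr C B A) (idn C B))"

section \<open>Comonadic covers and imaginary splittings\<close>

record ('o, 'a) imaginary_cat = "('o, 'a) pointed_cat" +
  cop :: "'o \<Rightarrow> 'o \<Rightarrow> 'o"
  inj1 :: "'o \<Rightarrow> 'o \<Rightarrow> 'a"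
  inj2 :: "'o \<Rightarrow> 'o \<Rightarrow> 'a"
  PO :: "'o \<Rightarrow> 'o"
  PA :: "'a \<Rightarrow> 'a"
  cou :: "'o \<Rightarrow> 'a"  ("\<epsilon>\<index>")
  com :: "'o \<Rightarrow> 'a"  ("\<delta>\<index>")
  spl :: "'o \<Rightarrow> 'o \<Rightarrow> 'a"  ("\<tau>\<index>")

definition copair :: "('o, 'a, 'e) imaginary_cat_scheme \<Rightarrow> 'a \<Rightarrow> 'a \<Rightarrow> 'a" where
  "copair C f g = (THE h. h \<in> hom C (cop C (src C f) (src C g)) (tgt C f) \<and>
    h \<cdot>\<^bsub>C\<^esub> inj1 C (src C f) (src C g) = f \<and> h \<cdot>\<^bsub>C\<^esub> inj2 C (src C f) (src C g) = g)"

definition cop_arr :: "('o, 'a, 'e) imaginary_cat_scheme \<Rightarrow> 'a \<Rightarrow> 'a \<Rightarrow> 'a" where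
  "cop_arr C f g = copair C (inj1 C (tgt C f) (tgt C g) \<cdot>\<^bsub>C\<^esub> f)
                            (inj2 C (tgt C f) (tgt C g) \<cdot>\<^bsub>C\<^esub> g)"

definition comparison :: "('o, 'a, 'e) imaginary_cat_scheme \<Rightarrow> 'o \<Rightarrow> 'o \<Rightarrow> 'a" where
  "comparison C A B = pair C (copair C (idn C A) (zero_arr C B A))
                             (copair C (zero_arr C A B) (idn C B))"

locale binary_coproducts = category C
  for C :: "('o, 'a, 'e) imaginary_cat_scheme" (structure) +
  assumes cop_coproduct: "\<lbrakk>A \<in> Ob C; B \<in> Ob C\<rbrakk>
      \<Longrightarrow> is_coproduct C A B (cop C A B) (inj1 C A B) (inj2 C A B)"

locale comonadic_covers = category C
  for C :: "('o, 'a, 'e) imaginary_cat_scheme" (structure) +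
  assumes PO_Ob: "A \<in> Ob C \<Longrightarrow> PO C A \<in> Ob C"
    and PA_hom: "f \<in> hom C A B \<Longrightarrow> PA C f \<in> hom C (PO C A) (PO C B)"
    and PA_idn: "A \<in> Ob C \<Longrightarrow> PA C (idn C A) = idn C (PO C A)"
    and PA_cmp: "\<lbrakk>f \<in> hom C A B; g \<in> hom C B D\<rbrakk> \<Longrightarrow> PA C (g \<cdot> f) = PA C g \<cdot> PA C f"
    and counit_hom: "A \<in> Ob C \<Longrightarrow> \<epsilon> A \<in> hom C (PO C A) A"
    and counit_natural: "f \<in> hom C A B \<Longrightarrow> \<epsilon> B \<cdot> PA C f = f \<cdot> \<epsilon> A"
    and comult_hom: "A \<in> Ob C \<Longrightarrow> \<delta> A \<in> hom C (PO C A) (PO C (PO C A))"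
    and comult_natural: "f \<in> hom C A B \<Longrightarrow> \<delta> B \<cdot> PA C f = PA C (PA C f) \<cdot> \<delta> A"
    and counit_left: "A \<in> Ob C \<Longrightarrow> \<epsilon> (PO C A) \<cdot> \<delta> A = idn C (PO C A)"
    and counit_right: "A \<in> Ob C \<Longrightarrow> PA C (\<epsilon> A) \<cdot> \<delta> A = idn C (PO C A)"
    and comult_coassoc: "A \<in> Ob C \<Longrightarrow> \<delta> (PO C A) \<cdot> \<delta> A = PA C (\<delta> A) \<cdot> \<delta> A"
    and counit_regular_epi: "A \<in> Ob C \<Longrightarrow> is_regular_epi C (\<epsilon> A)"

locale natural_imaginary_splitting =
  unital_category C + binary_coproducts C + comonadic_covers C
  for C :: "('o, 'a, 'e) imaginary_cat_scheme" (structure) +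
  assumes spl_hom: "\<lbrakk>A \<in> Ob C; B \<in> Ob C\<rbrakk> \<Longrightarrow> \<tau> A B \<in> hom C (PO C (prd C A B)) (cop C A B)"
    and spl_natural: "\<lbrakk>f \<in> hom C A A'; g \<in> hom C B B'\<rbrakk>
      \<Longrightarrow> \<tau> A' B' \<cdot> PA C (prod_arr C f g) = cop_arr C f g \<cdot> \<tau> A B"
    and spl_splits: "\<lbrakk>A \<in> Ob C; B \<in> Ob C\<rbrakk> \<Longrightarrow> comparison C A B \<cdot> \<tau> A B = \<epsilon> (prd C A B)"

section \<open>Imaginary morphisms\<close>

definition im_hom :: "('o, 'a, 'e) imaginary_cat_scheme \<Rightarrow> 'o \<Rightarrow> 'o \<Rightarrow> 'a set" where
  "im_hom C X Y = hom C (PO C X) Y"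

definition real_im :: "('o, 'a, 'e) imaginary_cat_scheme \<Rightarrow> 'a \<Rightarrow> 'a" where
  "real_im C f = f \<cdot>\<^bsub>C\<^esub> \<epsilon>\<^bsub>C\<^esub> (src C f)"

text \<open>Composite of \<open>a\<close> from \<open>A\<close> to \<open>B\<close> with \<open>b\<close> from \<open>B\<close>, both imaginary. The object \<open>A\<close> is an
  argument because it cannot be recovered from \<open>a\<close>, whose source in the category is \<open>P(A)\<close>.\<close>

definition im_cmp :: "('o, 'a, 'e) imaginary_cat_scheme \<Rightarrow> 'o \<Rightarrow> 'a \<Rightarrow> 'a \<Rightarrow> 'a" where
  "im_cmp C A b a = b \<cdot>\<^bsub>C\<^esub> (PA C a \<cdot>\<^bsub>C\<^esub> \<delta>\<^bsub>C\<^esub> A)"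

text \<open>Composite of an imaginary \<open>a\<close> with a real \<open>u\<close> on the right.\<close>

definition im_real_cmp :: "('o, 'a, 'e) imaginary_cat_scheme \<Rightarrow> 'a \<Rightarrow> 'a \<Rightarrow> 'a" where
  "im_real_cmp C a u = a \<cdot>\<^bsub>C\<^esub> PA C u"

text \<open>\<open>a \<times> b\<close> for imaginary \<open>a\<close> and \<open>b\<close> with imaginary domains \<open>A\<close> and \<open>B\<close>.\<close>

definition im_prod_arr ::
  "('o, 'a, 'e) imaginary_cat_scheme \<Rightarrow> 'o \<Rightarrow> 'o \<Rightarrow> 'a \<Rightarrow> 'a \<Rightarrow> 'a" where
  "im_prod_arr C A B a b = pair C (im_real_cmp C a (prj1 C A B)) (im_real_cmp C b (prj2 C A B))"

definition im_add :: "('o, 'a, 'e) imaginary_cat_scheme \<Rightarrow> 'o \<Rightarrow> 'a"  ("\<mu>\<index>") where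
  "\<mu>\<^bsub>C\<^esub> X = copair C (idn C X) (idn C X) \<cdot>\<^bsub>C\<^esub> \<tau>\<^bsub>C\<^esub> X X"

text \<open>The triple product is \<open>(X \<times> X) \<times> X\<close>.\<close>

definition natural_addition_associative ::
  "('o, 'a, 'e) imaginary_cat_scheme \<Rightarrow> bool" where
  "natural_addition_associative C \<longleftrightarrow> (\<forall>X \<in> Ob C.
    im_cmp C (prd C (prd C X X) X) (\<mu>\<^bsub>C\<^esub> X)
      (im_prod_arr C (prd C X X) X (\<mu>\<^bsub>C\<^esub> X) (real_im C (idn C X))) =
    im_real_cmp C
      (im_cmp C (prd C X (prd C X X)) (\<mu>\<^bsub>C\<^esub> X)
        (im_prod_arr C X (prd C X X) (real_im C (idn C X)) (\<mu>\<^bsub>C\<^esub> X)))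
      (prod_assoc C X X X))"

text \<open>\<open>f\<close> from \<open>X\<close> to \<open>Y\<close> with chosen section \<open>s\<close> and kernel \<open>k\<close>.\<close>

definition intrinsic_schreier_split_ext ::
  "('o, 'a, 'e) imaginary_cat_scheme \<Rightarrow> 'o \<Rightarrow> 'o \<Rightarrow> 'o \<Rightarrow> 'a \<Rightarrow> 'a \<Rightarrow> 'a \<Rightarrow> bool" where
  "intrinsic_schreier_split_ext C K X Y k f s \<longleftrightarrow>
    f \<in> hom C X Y \<and> s \<in> hom C Y X \<and> f \<cdot>\<^bsub>C\<^esub> s = idn C Y \<and> is_kernel C f K k \<and>
    (\<exists>q \<in> im_hom C X K.
      im_cmp C X (\<mu>\<^bsub>C\<^esub> X) (pair C (k \<cdot>\<^bsub>C\<^esub> q) (real_im C (s \<cdot>\<^bsub>C\<^esub> f))) = real_im C (idn C X) \<and>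
      im_cmp C (prd C K Y) q (im_real_cmp C (\<mu>\<^bsub>C\<^esub> X) (prod_arr C k s)) =
        real_im C (prj1 C K Y))"

definition intrinsic_schreier_split_epi ::
  "('o, 'a, 'e) imaginary_cat_scheme \<Rightarrow> 'o \<Rightarrow> 'o \<Rightarrow> 'a \<Rightarrow> 'a \<Rightarrow> bool" where
  "intrinsic_schreier_split_epi C X Y f s \<longleftrightarrow>
    (\<exists>K k. intrinsic_schreier_split_ext C K X Y k f s)"

end

theory Submission
  imports Defs
begin

text \<open>
  The argument is the classical one for Schreier extensions of monoids, read in the Kleisli
  category of \<open>P\<close>. Imaginary morphisms \<open>x, y\<close> from \<open>V\<close> to \<open>X\<close> are treated as generalized elements
  of \<open>X\<close> and are added by \<open>x + y = \<mu> \<circ> \<langle>x, y\<rangle>\<close>. The proof rests on three properties of this addition: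
  real morphisms preserve it (\<open>cmp_im_sum\<close>, which is naturality of the splitting), precomposition
  with imaginary morphisms preserves it (\<open>im_cmp_im_sum\<close>), and it is associative
  (\<open>im_sum_assoc\<close>, where the hypothesis on \<open>\<mu>\<close> enters).

  For a split epimorphism \<open>f\<close> with section \<open>s\<close> and kernel \<open>k\<close>, the two Schreier conditions on \<open>q\<close>
  then say that \<open>x = k q(x) + s f(x)\<close> (\<open>schreier_decomposition\<close>) and \<open>q(k a + s y) = a\<close>
  (\<open>schreier_retraction_iff\<close>) for all generalized elements. Let \<open>q\<close> be such a morphism for \<open>f\<close>, let \<open>l\<close>
  be the kernel of \<open>g\<close> and \<open>r\<close> its Schreier retraction, and let \<open>n\<close> be a kernel of \<open>gf\<close>. Then
  \<open>m(x) = k q(x) + s l r(f x)\<close> is annihilated by \<open>gf\<close>, so \<open>m = n q'\<close> for a unique \<open>q'\<close>, and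
    \<open>m(x) + s v g f x = k q(x) + s (l r(f x) + v g f x) = k q(x) + s f x = x\<close>.
  For \<open>c\<close> in the kernel of \<open>gf\<close>, the element \<open>f n c\<close> lies in the kernel of \<open>g\<close>, say \<open>f n c = l b\<close>.
  As \<open>n c + s v z = k q(n c) + s (l b + v z)\<close>, applying \<open>q\<close> to it gives \<open>q(n c)\<close>, while applying
  \<open>r f\<close> gives \<open>b\<close>; hence \<open>m(n c + s v z) = k q(n c) + s f n c = n c\<close>, and \<open>n\<close> is monic.
\<close>

section \<open>Pairings, copairings and zero morphisms\<close>

context category
begin

lemma homD:
  assumes "f \<in> hom C A B"
  shows "src C f = A" "tgt C f = B" "A \<in> Ob C" "B \<in> Ob C"
  using assms src_Ob tgt_Ob by (auto simp: hom_def)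

lemma is_product_ex1:
  assumes "is_product C A B W p q" and "x \<in> hom C V A" and "y \<in> hom C V B"
  shows "\<exists>!h. h \<in> hom C V W \<and> p \<cdot> h = x \<and> q \<cdot> h = y"
  by (rule assms(1)[unfolded is_product_def, THEN conjunct2, THEN conjunct2, THEN spec,
        THEN bspec, OF assms(2), THEN bspec, OF assms(3)])

lemma is_coproduct_ex1:
  assumes "is_coproduct C A B W i j" and "x \<in> hom C A V" and "y \<in> hom C B V"
  shows "\<exists>!h. h \<in> hom C W V \<and> h \<cdot> i = x \<and> h \<cdot> j = y"
  by (rule assms(1)[unfolded is_coproduct_def, THEN conjunct2, THEN conjunct2, THEN spec,
        THEN bspec, OF assms(2), THEN bspec, OF assms(3)])

lemma is_equalizerD:
  assumes "is_equalizer C f g E e" and f: "f \<in> hom C A B"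
  shows "e \<in> hom C E A" "f \<cdot> e = g \<cdot> e"
    "\<And>V x. x \<in> hom C V A \<Longrightarrow> f \<cdot> x = g \<cdot> x \<Longrightarrow> \<exists>!h. h \<in> hom C V E \<and> e \<cdot> h = x"
proof -
  obtain A' B' where *: "f \<in> hom C A' B'" "e \<in> hom C E A'" "f \<cdot> e = g \<cdot> e"
    "\<forall>V. \<forall>x \<in> hom C V A'. f \<cdot> x = g \<cdot> x \<longrightarrow> (\<exists>!h. h \<in> hom C V E \<and> e \<cdot> h = x)"
    using assms(1) unfolding is_equalizer_def by (elim exE conjE) (rule that)
  have "A' = A" using homD(1)[OF *(1)] homD(1)[OF f] by simp
  then show "e \<in> hom C E A" "f \<cdot> e = g \<cdot> e"
    "\<And>V x. x \<in> hom C V A \<Longrightarrow> f \<cdot> x = g \<cdot> x \<Longrightarrow> \<exists>!h. h \<in> hom C V E \<and> e \<cdot> h = x"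
    using * by simp_all
qed

lemma is_equalizer_mono:
  assumes e: "is_equalizer C f g E e" and f: "f \<in> hom C A B" and g: "g \<in> hom C A B"
    and x: "x \<in> hom C V E" and y: "y \<in> hom C V E" and eq: "e \<cdot> x = e \<cdot> y"
  shows "x = y"
proof -
  note E = is_equalizerD[OF e f]
  have "f \<cdot> (e \<cdot> x) = g \<cdot> (e \<cdot> x)"
    by (simp only: cmp_assoc[OF x E(1) f, symmetric] cmp_assoc[OF x E(1) g, symmetric] E(2))
  from E(3)[OF cmp_hom[OF x E(1)] this] show ?thesis
    using x y eq by (elim ex1E) metis
qed

end

context unital_category
begin

lemma prd_homs:
  assumes "A \<in> Ob C" "B \<in> Ob C"
  shows "prj1 C A B \<in> hom C (prd C A B) A" "prj2 C A B \<in> hom C (prd C A B) B"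
    "prd C A B \<in> Ob C"
  using prd_product[OF assms] homD unfolding is_product_def by blast+

lemma pair_props:
  assumes f: "f \<in> hom C V A" and g: "g \<in> hom C V B"
  shows "pair C f g \<in> hom C V (prd C A B)"
    "prj1 C A B \<cdot> pair C f g = f" "prj2 C A B \<cdot> pair C f g = g"
proof -
  have "\<exists>!h. h \<in> hom C V (prd C A B) \<and> prj1 C A B \<cdot> h = f \<and> prj2 C A B \<cdot> h = g"
    using prd_product[OF homD(4)[OF f] homD(4)[OF g]] f g by (rule is_product_ex1)
  from theI'[OF this] show "pair C f g \<in> hom C V (prd C A B)"
    "prj1 C A B \<cdot> pair C f g = f" "prj2 C A B \<cdot> pair C f g = g"
    by (simp_all add: pair_def homD(1,2)[OF f] homD(1,2)[OF g])
qed

lemma prd_eqI: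
  assumes "A \<in> Ob C" "B \<in> Ob C" "x \<in> hom C V (prd C A B)" "y \<in> hom C V (prd C A B)"
    and "prj1 C A B \<cdot> x = prj1 C A B \<cdot> y" "prj2 C A B \<cdot> x = prj2 C A B \<cdot> y"
  shows "x = y"
proof -
  have "prj1 C A B \<cdot> x \<in> hom C V A" "prj2 C A B \<cdot> x \<in> hom C V B"
    by (rule cmp_hom[OF assms(3) prd_homs(1)[OF assms(1,2)]]
      cmp_hom[OF assms(3) prd_homs(2)[OF assms(1,2)]])+
  then have "\<exists>!h. h \<in> hom C V (prd C A B) \<and> prj1 C A B \<cdot> h = prj1 C A B \<cdot> x
      \<and> prj2 C A B \<cdot> h = prj2 C A B \<cdot> x"
    by (rule is_product_ex1[OF prd_product[OF assms(1,2)]])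
  then show ?thesis using assms by metis
qed

lemma pair_cmp:
  assumes f: "f \<in> hom C V A" and g: "g \<in> hom C V B" and h: "h \<in> hom C W V"
  shows "pair C f g \<cdot> h = pair C (f \<cdot> h) (g \<cdot> h)"
proof -
  note A = homD[OF f] and B = homD[OF g]
  note fh = cmp_hom[OF h f] and gh = cmp_hom[OF h g]
  note p = prd_homs[OF A(4) B(4)]
  show ?thesis
  proof (rule prd_eqI[OF A(4) B(4)])
    show "pair C f g \<cdot> h \<in> hom C W (prd C A B)"
      by (rule cmp_hom[OF h pair_props(1)[OF f g]])
    show "pair C (f \<cdot> h) (g \<cdot> h) \<in> hom C W (prd C A B)"
      using pair_props(1)[OF fh gh] .
    show "prj1 C A B \<cdot> (pair C f g \<cdot> h) = prj1 C A B \<cdot> pair C (f \<cdot> h) (g \<cdot> h)"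
      using cmp_assoc[OF h pair_props(1)[OF f g] p(1)] pair_props(2)[OF f g]
        pair_props(2)[OF fh gh] by simp
    show "prj2 C A B \<cdot> (pair C f g \<cdot> h) = prj2 C A B \<cdot> pair C (f \<cdot> h) (g \<cdot> h)"
      using cmp_assoc[OF h pair_props(1)[OF f g] p(2)] pair_props(3)[OF f g]
        pair_props(3)[OF fh gh] by simp
  qed
qed

lemma prod_arr_hom:
  assumes f: "f \<in> hom C A A'" and g: "g \<in> hom C B B'"
  shows "prod_arr C f g \<in> hom C (prd C A B) (prd C A' B')"
  unfolding prod_arr_def homD(1,2)[OF f] homD(1,2)[OF g]
  by (rule pair_props(1)[OF cmp_hom[OF prd_homs(1) f] cmp_hom[OF prd_homs(2) g]])
    (rule homD(3)[OF f] homD(3)[OF g])+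

lemma prod_arr_pair:
  assumes f: "f \<in> hom C A A'" and g: "g \<in> hom C B B'"
    and x: "x \<in> hom C V A" and y: "y \<in> hom C V B"
  shows "prod_arr C f g \<cdot> pair C x y = pair C (f \<cdot> x) (g \<cdot> y)"
proof -
  note p = prd_homs[OF homD(3)[OF f] homD(3)[OF g]]
  note xy = pair_props[OF x y]
  show ?thesis
    unfolding prod_arr_def homD[OF f] homD[OF g]
    using pair_cmp[OF cmp_hom[OF p(1) f] cmp_hom[OF p(2) g] xy(1)]
      cmp_assoc[OF xy(1) p(1) f] cmp_assoc[OF xy(1) p(2) g] xy(2,3) by simp
qed

lemma prod_assoc_pair:
  assumes x: "x \<in> hom C V A" and y: "y \<in> hom C V B" and z: "z \<in> hom C V D"
  shows "prod_assoc C A B D \<in> hom C (prd C (prd C A B) D) (prd C A (prd C B D))"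
    "prod_assoc C A B D \<cdot> pair C (pair C x y) z = pair C x (pair C y z)"
proof -
  note A = homD(4)[OF x] and B = homD(4)[OF y] and D = homD(4)[OF z]
  note p = prd_homs[OF A B] note P = prd_homs[OF p(3) D]
  note xy = pair_props[OF x y] note w = pair_props[OF xy(1) z]
  note p1 = cmp_hom[OF P(1) p(1)] and p2 = cmp_hom[OF P(1) p(2)]
  note p23 = pair_props[OF p2 P(2)]
  show "prod_assoc C A B D \<in> hom C (prd C (prd C A B) D) (prd C A (prd C B D))"
    unfolding prod_assoc_def by (rule pair_props(1)[OF p1 p23(1)])
  show "prod_assoc C A B D \<cdot> pair C (pair C x y) z = pair C x (pair C y z)"
    unfolding prod_assoc_def pair_cmp[OF p1 p23(1) w(1)] pair_cmp[OF p2 P(2) w(1)]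
      cmp_assoc[OF w(1) P(1) p(1)] cmp_assoc[OF w(1) P(1) p(2)] w(2,3) xy(2,3) ..
qed

lemma zer_hom_ex1:
  assumes "A \<in> Ob C"
  shows "\<exists>!f. f \<in> hom C (zer C) A" "\<exists>!f. f \<in> hom C A (zer C)"
  using zer_initial zer_terminal assms by (simp_all add: is_initial_def is_terminal_def)

lemma zero_arr_factors:
  assumes A: "A \<in> Ob C" and B: "B \<in> Ob C"
  obtains i j where "i \<in> hom C (zer C) B" "j \<in> hom C A (zer C)" "zero_arr C A B = i \<cdot> j"
  by (rule that[OF theI'[OF zer_hom_ex1(1)[OF B]] theI'[OF zer_hom_ex1(2)[OF A]]])
    (rule zero_arr_def)

lemma zero_arr_hom:
  assumes "A \<in> Ob C" "B \<in> Ob C"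
  shows "zero_arr C A B \<in> hom C A B"
  by (rule zero_arr_factors[OF assms]) (simp add: cmp_hom)

lemma factors_through_zero:
  assumes i: "i \<in> hom C (zer C) B" and j: "j \<in> hom C A (zer C)"
  shows "i \<cdot> j = zero_arr C A B"
proof -
  obtain i' j' where *: "i' \<in> hom C (zer C) B" "j' \<in> hom C A (zer C)" "zero_arr C A B = i' \<cdot> j'"
    by (rule zero_arr_factors[OF homD(3)[OF j] homD(4)[OF i]])
  have "i = i'" using zer_hom_ex1(1)[OF homD(4)[OF i]] i *(1) by (elim ex1E) metis
  moreover have "j = j'" using zer_hom_ex1(2)[OF homD(3)[OF j]] j *(2) by (elim ex1E) metis
  ultimately show ?thesis using *(3) by simp
qed

lemma cmp_zero_arr:
  assumes u: "u \<in> hom C A B" and W: "W \<in> Ob C"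
  shows "u \<cdot> zero_arr C W A = zero_arr C W B"
proof -
  obtain i j where ij: "i \<in> hom C (zer C) A" "j \<in> hom C W (zer C)" "zero_arr C W A = i \<cdot> j"
    using zero_arr_factors[OF W homD(3)[OF u]] .
  show ?thesis
    using cmp_assoc[OF ij(2,1) u] factors_through_zero[OF cmp_hom[OF ij(1) u] ij(2)] ij(3) by simp
qed

lemma zero_arr_cmp:
  assumes u: "u \<in> hom C A B" and W: "W \<in> Ob C"
  shows "zero_arr C B W \<cdot> u = zero_arr C A W"
proof -
  obtain i j where ij: "i \<in> hom C (zer C) W" "j \<in> hom C B (zer C)" "zero_arr C B W = i \<cdot> j"
    using zero_arr_factors[OF homD(4)[OF u] W] .
  show ?thesis
    using cmp_assoc[OF u ij(2,1)] factors_through_zero[OF ij(1) cmp_hom[OF u ij(2)]] ij(3) by simp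
qed

lemma kernel_props:
  assumes "is_kernel C f K k" and f: "f \<in> hom C A B"
  shows "k \<in> hom C K A" "f \<cdot> k = zero_arr C K B"
    "\<And>V x. x \<in> hom C V A \<Longrightarrow> f \<cdot> x = zero_arr C V B \<Longrightarrow> \<exists>!h. h \<in> hom C V K \<and> k \<cdot> h = x"
    "\<And>V x y. x \<in> hom C V K \<Longrightarrow> y \<in> hom C V K \<Longrightarrow> k \<cdot> x = k \<cdot> y \<Longrightarrow> x = y"
proof -
  have e: "is_equalizer C f (zero_arr C A B) K k"
    using assms(1) homD[OF f] by (simp add: is_kernel_def)
  note E = is_equalizerD[OF e f]
  show "k \<in> hom C K A" by (rule E(1))
  show "f \<cdot> k = zero_arr C K B"
    using E(2) zero_arr_cmp[OF E(1) homD(4)[OF f]] by simp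
  show "\<exists>!h. h \<in> hom C V K \<and> k \<cdot> h = x" if "x \<in> hom C V A" "f \<cdot> x = zero_arr C V B" for V x
    using E(3)[OF that(1)] that(2) zero_arr_cmp[OF that(1) homD(4)[OF f]] by simp
  show "x = y" if "x \<in> hom C V K" "y \<in> hom C V K" "k \<cdot> x = k \<cdot> y" for V x y
    by (rule is_equalizer_mono[OF e f zero_arr_hom[OF homD(3,4)[OF f]] that])
qed

lemma kernel_ex:
  assumes "f \<in> hom C A B"
  obtains K k where "is_kernel C f K k"
proof -
  obtain K k where "is_equalizer C f (zero_arr C A B) K k"
    using equalizer_ex[OF assms zero_arr_hom[OF homD(3,4)[OF assms]]] by blast
  then have "is_kernel C f K k" by (simp add: is_kernel_def homD(1,2)[OF assms])
  then show thesis by (rule that)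
qed

end

context binary_coproducts
begin

lemma cop_homs:
  assumes "A \<in> Ob C" "B \<in> Ob C"
  shows "inj1 C A B \<in> hom C A (cop C A B)" "inj2 C A B \<in> hom C B (cop C A B)"
  using cop_coproduct[OF assms] unfolding is_coproduct_def by blast+

lemma copair_props:
  assumes f: "f \<in> hom C A V" and g: "g \<in> hom C B V"
  shows "copair C f g \<in> hom C (cop C A B) V"
    "copair C f g \<cdot> inj1 C A B = f" "copair C f g \<cdot> inj2 C A B = g"
proof -
  have "\<exists>!h. h \<in> hom C (cop C A B) V \<and> h \<cdot> inj1 C A B = f \<and> h \<cdot> inj2 C A B = g"
    using cop_coproduct[OF homD(3)[OF f] homD(3)[OF g]] f g by (rule is_coproduct_ex1)
  from theI'[OF this] show "copair C f g \<in> hom C (cop C A B) V"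
    "copair C f g \<cdot> inj1 C A B = f" "copair C f g \<cdot> inj2 C A B = g"
    by (simp_all add: copair_def homD(1,2)[OF f] homD(1,2)[OF g])
qed

lemma copair_unique:
  assumes f: "f \<in> hom C A V" and g: "g \<in> hom C B V"
    and h: "h \<in> hom C (cop C A B) V" "h \<cdot> inj1 C A B = f" "h \<cdot> inj2 C A B = g"
  shows "h = copair C f g"
proof -
  have "\<exists>!h. h \<in> hom C (cop C A B) V \<and> h \<cdot> inj1 C A B = f \<and> h \<cdot> inj2 C A B = g"
    using cop_coproduct[OF homD(3)[OF f] homD(3)[OF g]] f g by (rule is_coproduct_ex1)
  then show ?thesis using copair_props[OF f g] h by blast
qed

text \<open>Both sides are the copairing of \<open>u\<close> with itself.\<close>

lemma codiagonal_natural: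
  assumes u: "u \<in> hom C A B"
  shows "cop_arr C u u \<in> hom C (cop C A A) (cop C B B)"
    "u \<cdot> copair C (idn C A) (idn C A) = copair C (idn C B) (idn C B) \<cdot> cop_arr C u u"
proof -
  note A = homD(3)[OF u] and B = homD(4)[OF u]
  note i = cop_homs[OF A A] and j = cop_homs[OF B B]
  note idA = idn_hom[OF A] and idB = idn_hom[OF B]
  note dA = copair_props[OF idA idA] and dB = copair_props[OF idB idB]
  note ju = cmp_hom[OF u j(1)] cmp_hom[OF u j(2)]
  have c: "cop_arr C u u = copair C (inj1 C B B \<cdot> u) (inj2 C B B \<cdot> u)"
    by (simp add: cop_arr_def homD[OF u])
  note cp = copair_props[OF ju, folded c]
  show "cop_arr C u u \<in> hom C (cop C A A) (cop C B B)" by (rule cp(1))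
  have "u \<cdot> copair C (idn C A) (idn C A) = copair C u u"
    by (rule copair_unique[OF u u cmp_hom[OF dA(1) u]])
      (simp_all add: cmp_assoc[OF i(1) dA(1) u] cmp_assoc[OF i(2) dA(1) u] dA(2,3)
        cmp_idn_right[OF u])
  moreover have "copair C (idn C B) (idn C B) \<cdot> cop_arr C u u = copair C u u"
    by (rule copair_unique[OF u u cmp_hom[OF cp(1) dB(1)]])
      (simp_all add: cmp_assoc[OF i(1) cp(1) dB(1)] cmp_assoc[OF i(2) cp(1) dB(1)] cp(2,3)
        cmp_assoc[OF u j(1) dB(1), symmetric] cmp_assoc[OF u j(2) dB(1), symmetric] dB(2,3)
        cmp_idn_left[OF u])
  ultimately show "u \<cdot> copair C (idn C A) (idn C A)
      = copair C (idn C B) (idn C B) \<cdot> cop_arr C u u" by simp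
qed

end

section \<open>The Kleisli category of imaginary morphisms\<close>

context comonadic_covers
begin

lemma real_im_hom:
  assumes u: "u \<in> hom C A B"
  shows "real_im C u \<in> hom C (PO C A) B"
  unfolding real_im_def homD[OF u] by (rule cmp_hom[OF counit_hom[OF homD(3)[OF u]] u])

lemma cmp_real_im:
  assumes u: "u \<in> hom C A B" and w: "w \<in> hom C B D"
  shows "w \<cdot> real_im C u = real_im C (w \<cdot> u)"
  unfolding real_im_def homD[OF u] homD[OF cmp_hom[OF u w]]
  using cmp_assoc[OF counit_hom[OF homD(3)[OF u]] u w] by simp

lemma im_real_cmp_hom:
  assumes b: "b \<in> hom C (PO C B) D" and u: "u \<in> hom C A B"
  shows "im_real_cmp C b u \<in> hom C (PO C A) D"
  unfolding im_real_cmp_def by (rule cmp_hom[OF PA_hom[OF u] b])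

lemma PA_comult_hom:
  assumes A: "A \<in> Ob C" and a: "a \<in> hom C (PO C A) B"
  shows "PA C a \<cdot> \<delta> A \<in> hom C (PO C A) (PO C B)"
  by (rule cmp_hom[OF comult_hom[OF A] PA_hom[OF a]])

lemma im_cmp_hom:
  assumes "A \<in> Ob C" "a \<in> hom C (PO C A) B" "b \<in> hom C (PO C B) D"
  shows "im_cmp C A b a \<in> hom C (PO C A) D"
  unfolding im_cmp_def by (rule cmp_hom[OF PA_comult_hom[OF assms(1,2)] assms(3)])

lemma cmp_im_cmp:
  assumes "A \<in> Ob C" "a \<in> hom C (PO C A) B" "b \<in> hom C (PO C B) D" "u \<in> hom C D E"
  shows "im_cmp C A (u \<cdot> b) a = u \<cdot> im_cmp C A b a"
  unfolding im_cmp_def by (rule cmp_assoc[OF PA_comult_hom[OF assms(1,2)] assms(3,4)])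

text \<open>Composition in the Kleisli category is associative because \<open>\<delta>\<close> is natural and
  coassociative.\<close>

lemma im_cmp_assoc:
  assumes A: "A \<in> Ob C" and a: "a \<in> hom C (PO C A) B" and b: "b \<in> hom C (PO C B) D"
    and c: "c \<in> hom C (PO C D) E"
  shows "im_cmp C A (im_cmp C B c b) a = im_cmp C A c (im_cmp C A b a)"
proof -
  note B = homD(4)[OF a]
  note Pa = PA_hom[OF a] and Pb = PA_hom[OF b] and dA = comult_hom[OF A] and dB = comult_hom[OF B]
  note PPa = PA_hom[OF Pa] and PdA = PA_hom[OF dA]
  note aa = PA_comult_hom[OF A a] and bb = PA_comult_hom[OF B b]
  have "PA C (b \<cdot> (PA C a \<cdot> \<delta> A)) \<cdot> \<delta> A = (PA C b \<cdot> (PA C (PA C a) \<cdot> PA C (\<delta> A))) \<cdot> \<delta> A"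
    by (simp only: PA_cmp[OF aa b] PA_cmp[OF dA Pa])
  also have "\<dots> = PA C b \<cdot> (PA C (PA C a) \<cdot> (PA C (\<delta> A) \<cdot> \<delta> A))"
    by (simp only: cmp_assoc[OF dA cmp_hom[OF PdA PPa] Pb] cmp_assoc[OF dA PdA PPa])
  also have "\<dots> = PA C b \<cdot> ((PA C (PA C a) \<cdot> \<delta> (PO C A)) \<cdot> \<delta> A)"
    by (simp only: comult_coassoc[OF A, symmetric]
        cmp_assoc[OF dA comult_hom[OF PO_Ob[OF A]] PPa])
  also have "\<dots> = PA C b \<cdot> ((\<delta> B \<cdot> PA C a) \<cdot> \<delta> A)"
    by (simp only: comult_natural[OF a])
  also have "\<dots> = (PA C b \<cdot> \<delta> B) \<cdot> (PA C a \<cdot> \<delta> A)"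
    by (simp only: cmp_assoc[OF dA Pa dB] cmp_assoc[OF aa dB Pb])
  finally show ?thesis
    unfolding im_cmp_def by (simp only: cmp_assoc[OF aa bb c])
qed

lemma im_cmp_real_im_left:
  assumes A: "A \<in> Ob C" and a: "a \<in> hom C (PO C A) B" and u: "u \<in> hom C B D"
  shows "im_cmp C A (real_im C u) a = u \<cdot> a"
proof -
  note B = homD(3)[OF u]
  note Pa = PA_hom[OF a] and dA = comult_hom[OF A]
  have "\<epsilon> B \<cdot> (PA C a \<cdot> \<delta> A) = (a \<cdot> \<epsilon> (PO C A)) \<cdot> \<delta> A"
    using cmp_assoc[OF dA Pa counit_hom[OF B]] counit_natural[OF a] by simp
  also have "\<dots> = a"
    using cmp_assoc[OF dA counit_hom[OF PO_Ob[OF A]] a] counit_left[OF A] cmp_idn_right[OF a]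
    by simp
  finally show ?thesis
    unfolding im_cmp_def real_im_def homD[OF u]
    using cmp_assoc[OF PA_comult_hom[OF A a] counit_hom[OF B] u] by simp
qed

lemma im_cmp_real_im_right:
  assumes u: "u \<in> hom C A B" and b: "b \<in> hom C (PO C B) D"
  shows "im_cmp C A b (real_im C u) = im_real_cmp C b u"
proof -
  note A = homD(3)[OF u]
  note e = counit_hom[OF A] and d = comult_hom[OF A]
  have "PA C (u \<cdot> \<epsilon> A) \<cdot> \<delta> A = PA C u"
    by (simp only: PA_cmp[OF e u] cmp_assoc[OF d PA_hom[OF e] PA_hom[OF u]] counit_right[OF A]
        cmp_idn_right[OF PA_hom[OF u]])
  then show ?thesis
    unfolding im_cmp_def real_im_def homD[OF u] im_real_cmp_def by simp
qed

lemma im_cmp_im_real_cmp: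
  assumes A: "A \<in> Ob C" and a: "a \<in> hom C (PO C A) B" and u: "u \<in> hom C B D"
    and c: "c \<in> hom C (PO C D) E"
  shows "im_cmp C A (im_real_cmp C c u) a = im_cmp C A c (u \<cdot> a)"
  by (simp only: im_cmp_real_im_right[OF u c, symmetric]
      im_cmp_assoc[OF A a real_im_hom[OF u] c] im_cmp_real_im_left[OF A a u])

end

section \<open>Addition of imaginary morphisms\<close>

context natural_imaginary_splitting
begin

lemma im_cmp_pair:
  assumes "V \<in> Ob C" "a \<in> hom C (PO C V) W" "x \<in> hom C (PO C W) A" "y \<in> hom C (PO C W) B"
  shows "im_cmp C V (pair C x y) a = pair C (im_cmp C V x a) (im_cmp C V y a)"
  unfolding im_cmp_def by (rule pair_cmp[OF assms(3,4) PA_comult_hom[OF assms(1,2)]])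

text \<open>The domain \<open>V\<close> is part of the notation because it cannot be recovered from \<open>P(V)\<close>.\<close>

definition im_sum :: "'a \<Rightarrow> 'o \<Rightarrow> 'a \<Rightarrow> 'a" ("_ \<oplus>\<^bsub>_\<^esub> _" [66, 0, 66] 65) where
  "x \<oplus>\<^bsub>V\<^esub> y = im_cmp C V (\<mu> (tgt C x)) (pair C x y)"

lemma im_add_hom:
  assumes X: "X \<in> Ob C"
  shows "\<mu> X \<in> hom C (PO C (prd C X X)) X"
  unfolding im_add_def
  by (rule cmp_hom[OF spl_hom[OF X X] copair_props(1)[OF idn_hom[OF X] idn_hom[OF X]]])

text \<open>Naturality of \<open>\<mu>\<close> combines naturality of the splitting with naturality of the codiagonal.\<close>

lemma im_add_natural:
  assumes u: "u \<in> hom C A B"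
  shows "u \<cdot> \<mu> A = \<mu> B \<cdot> PA C (prod_arr C u u)"
proof -
  note A = homD(3)[OF u] and B = homD(4)[OF u]
  note dA = copair_props(1)[OF idn_hom[OF A] idn_hom[OF A]]
  note dB = copair_props(1)[OF idn_hom[OF B] idn_hom[OF B]]
  note c = codiagonal_natural[OF u]
  have "u \<cdot> \<mu> A = (copair C (idn C B) (idn C B) \<cdot> cop_arr C u u) \<cdot> \<tau> A A"
    by (simp only: im_add_def cmp_assoc[OF spl_hom[OF A A] dA u, symmetric] c(2))
  also have "\<dots> = copair C (idn C B) (idn C B) \<cdot> (\<tau> B B \<cdot> PA C (prod_arr C u u))"
    by (simp only: cmp_assoc[OF spl_hom[OF A A] c(1) dB] spl_natural[OF u u])
  also have "\<dots> = \<mu> B \<cdot> PA C (prod_arr C u u)"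
    by (simp only: im_add_def
        cmp_assoc[OF PA_hom[OF prod_arr_hom[OF u u]] spl_hom[OF B B] dB])
  finally show ?thesis .
qed

lemma im_sum_hom:
  assumes "V \<in> Ob C" and x: "x \<in> hom C (PO C V) X" and y: "y \<in> hom C (PO C V) X"
  shows "x \<oplus>\<^bsub>V\<^esub> y \<in> hom C (PO C V) X"
  unfolding im_sum_def homD(2)[OF x]
  by (rule im_cmp_hom[OF assms(1) pair_props(1)[OF x y] im_add_hom[OF homD(4)[OF x]]])

lemma cmp_im_sum:
  assumes V: "V \<in> Ob C" and x: "x \<in> hom C (PO C V) X" and y: "y \<in> hom C (PO C V) X"
    and u: "u \<in> hom C X Y"
  shows "u \<cdot> (x \<oplus>\<^bsub>V\<^esub> y) = u \<cdot> x \<oplus>\<^bsub>V\<^esub> u \<cdot> y"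
proof -
  note X = homD(3)[OF u] and Y = homD(4)[OF u]
  note p = pair_props(1)[OF x y]
  have "u \<cdot> (x \<oplus>\<^bsub>V\<^esub> y) = im_cmp C V (im_real_cmp C (\<mu> Y) (prod_arr C u u)) (pair C x y)"
    unfolding im_sum_def homD(2)[OF x] im_real_cmp_def
    by (simp only: cmp_im_cmp[OF V p im_add_hom[OF X] u, symmetric] im_add_natural[OF u])
  also have "\<dots> = u \<cdot> x \<oplus>\<^bsub>V\<^esub> u \<cdot> y"
    unfolding im_sum_def homD(2)[OF cmp_hom[OF x u]]
    by (simp only: im_cmp_im_real_cmp[OF V p prod_arr_hom[OF u u] im_add_hom[OF Y]]
        prod_arr_pair[OF u u x y])
  finally show ?thesis .
qed

lemma im_cmp_im_sum:
  assumes V: "V \<in> Ob C" and W: "W \<in> Ob C" and a: "a \<in> hom C (PO C V) W"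
    and x: "x \<in> hom C (PO C W) X" and y: "y \<in> hom C (PO C W) X"
  shows "im_cmp C V (x \<oplus>\<^bsub>W\<^esub> y) a = im_cmp C V x a \<oplus>\<^bsub>V\<^esub> im_cmp C V y a"
  unfolding im_sum_def homD(2)[OF x] homD(2)[OF im_cmp_hom[OF V a x]]
  by (simp only: im_cmp_assoc[OF V a pair_props(1)[OF x y] im_add_hom[OF homD(4)[OF x]]]
      im_cmp_pair[OF V a x y])

text \<open>The zero morphism is itself real, hence preserves sums; this gives \<open>0 + 0 = 0\<close>.\<close>

lemma im_sum_zero_zero:
  assumes V: "V \<in> Ob C" and X: "X \<in> Ob C"
  shows "zero_arr C (PO C V) X \<oplus>\<^bsub>V\<^esub> zero_arr C (PO C V) X = zero_arr C (PO C V) X"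
proof -
  note e = counit_hom[OF V] and z = zero_arr_hom[OF V X]
  have "zero_arr C V X \<cdot> (\<epsilon> V \<oplus>\<^bsub>V\<^esub> \<epsilon> V) = zero_arr C V X \<cdot> \<epsilon> V \<oplus>\<^bsub>V\<^esub> zero_arr C V X \<cdot> \<epsilon> V"
    by (rule cmp_im_sum[OF V e e z])
  then show ?thesis
    by (simp add: zero_arr_cmp[OF e X] zero_arr_cmp[OF im_sum_hom[OF V e e] X])
qed

text \<open>Associativity of \<open>\<mu>\<close> is the instance of this law at the three projections; precomposing
  that instance with \<open>\<langle>\<langle>x, y\<rangle>, z\<rangle>\<close> yields the general one.\<close>

lemma im_sum_assoc:
  assumes assoc: "natural_addition_associative C" and V: "V \<in> Ob C"
    and x: "x \<in> hom C (PO C V) X" and y: "y \<in> hom C (PO C V) X" and z: "z \<in> hom C (PO C V) X"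
  shows "(x \<oplus>\<^bsub>V\<^esub> y) \<oplus>\<^bsub>V\<^esub> z = x \<oplus>\<^bsub>V\<^esub> (y \<oplus>\<^bsub>V\<^esub> z)"
proof -
  note X = homD(4)[OF x]
  note p = prd_homs[OF X X] note P = prd_homs[OF p(3) X] and Q = prd_homs[OF X p(3)]
  note m = im_add_hom[OF X] and i = real_im_hom[OF idn_hom[OF X]]
  note xy = pair_props[OF x y] and yz = pair_props[OF y z]
  note l = pair_props[OF xy(1) z] and r = pair_props[OF x yz(1)]
  note L1 = im_real_cmp_hom[OF m P(1)] and L2 = im_real_cmp_hom[OF i P(2)]
  note R1 = im_real_cmp_hom[OF i Q(1)] and R2 = im_real_cmp_hom[OF m Q(2)]
  note a = prod_assoc_pair[OF x y z]
  have i_x: "im_cmp C V (real_im C (idn C X)) w = w" if "w \<in> hom C (PO C V) X" for w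
    using im_cmp_real_im_left[OF V that idn_hom[OF X]] cmp_idn_left[OF that] by simp
  have "im_cmp C V (im_cmp C (prd C (prd C X X) X) (\<mu> X)
      (im_prod_arr C (prd C X X) X (\<mu> X) (real_im C (idn C X)))) (pair C (pair C x y) z)
    = im_cmp C V (\<mu> X) (pair C (im_cmp C V (\<mu> X) (pair C x y)) z)"
    unfolding im_prod_arr_def
    by (simp only: im_cmp_assoc[OF V l(1) pair_props(1)[OF L1 L2] m] im_cmp_pair[OF V l(1) L1 L2]
        im_cmp_im_real_cmp[OF V l(1) P(1) m] im_cmp_im_real_cmp[OF V l(1) P(2) i] l(2,3) i_x[OF z])
  also have "\<dots> = (x \<oplus>\<^bsub>V\<^esub> y) \<oplus>\<^bsub>V\<^esub> z"
    using homD(2)[OF im_sum_hom[OF V x y]] homD(2)[OF x] by (simp add: im_sum_def)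
  finally have left: "im_cmp C V (im_cmp C (prd C (prd C X X) X) (\<mu> X)
      (im_prod_arr C (prd C X X) X (\<mu> X) (real_im C (idn C X)))) (pair C (pair C x y) z)
    = (x \<oplus>\<^bsub>V\<^esub> y) \<oplus>\<^bsub>V\<^esub> z" .
  have "im_cmp C V (im_real_cmp C (im_cmp C (prd C X (prd C X X)) (\<mu> X)
        (im_prod_arr C X (prd C X X) (real_im C (idn C X)) (\<mu> X))) (prod_assoc C X X X))
      (pair C (pair C x y) z)
    = im_cmp C V (\<mu> X) (pair C x (im_cmp C V (\<mu> X) (pair C y z)))"
    unfolding im_prod_arr_def
    by (simp only: im_cmp_im_real_cmp[OF V l(1) a(1) im_cmp_hom[OF Q(3) pair_props(1)[OF R1 R2] m]]
        a(2) im_cmp_assoc[OF V r(1) pair_props(1)[OF R1 R2] m] im_cmp_pair[OF V r(1) R1 R2]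
        im_cmp_im_real_cmp[OF V r(1) Q(1) i] im_cmp_im_real_cmp[OF V r(1) Q(2) m] r(2,3) i_x[OF x])
  also have "\<dots> = x \<oplus>\<^bsub>V\<^esub> (y \<oplus>\<^bsub>V\<^esub> z)"
    using homD(2)[OF y] homD(2)[OF x] by (simp add: im_sum_def)
  finally show ?thesis
    using left assoc X unfolding natural_addition_associative_def by metis
qed

section \<open>Composition of intrinsic Schreier split extensions\<close>

text \<open>The second Schreier condition is the law \<open>q(k a + s y) = a\<close> for the two projections, which
  are the universal pair \<open>(a, y)\<close> of generalized elements.\<close>

lemma schreier_retraction_iff:
  assumes k: "k \<in> hom C K X" and s: "s \<in> hom C Y X" and q: "q \<in> hom C (PO C X) K"
  shows "im_cmp C (prd C K Y) q (im_real_cmp C (\<mu> X) (prod_arr C k s)) = real_im C (prj1 C K Y)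
    \<longleftrightarrow> (\<forall>V \<in> Ob C. \<forall>a \<in> hom C (PO C V) K. \<forall>y \<in> hom C (PO C V) Y.
          im_cmp C V q (k \<cdot> a \<oplus>\<^bsub>V\<^esub> s \<cdot> y) = a)" (is "?L = real_im C ?p \<longleftrightarrow> _")
proof -
  note K = homD(3)[OF k] and X = homD(4)[OF k] and Y = homD(3)[OF s]
  note p = prd_homs[OF K Y] and m = im_add_hom[OF X]
  note ks = prod_arr_hom[OF k s]
  have precomp: "im_cmp C V ?L (pair C a y) = im_cmp C V q (k \<cdot> a \<oplus>\<^bsub>V\<^esub> s \<cdot> y)"
    if V: "V \<in> Ob C" and a: "a \<in> hom C (PO C V) K" and y: "y \<in> hom C (PO C V) Y" for V a y
    unfolding im_sum_def homD(2)[OF cmp_hom[OF a k]]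
    by (simp only: im_cmp_assoc[OF V pair_props(1)[OF a y] im_real_cmp_hom[OF m ks] q]
        im_cmp_im_real_cmp[OF V pair_props(1)[OF a y] ks m] prod_arr_pair[OF k s a y])
  show ?thesis
  proof (intro iffI ballI)
    fix V a y
    assume L: "?L = real_im C ?p" and V: "V \<in> Ob C"
      and a: "a \<in> hom C (PO C V) K" and y: "y \<in> hom C (PO C V) Y"
    show "im_cmp C V q (k \<cdot> a \<oplus>\<^bsub>V\<^esub> s \<cdot> y) = a"
      by (simp only: precomp[OF V a y, symmetric] L pair_props(2)[OF a y]
          im_cmp_real_im_left[OF V pair_props(1)[OF a y] p(1)])
  next
    assume *: "\<forall>V \<in> Ob C. \<forall>a \<in> hom C (PO C V) K. \<forall>y \<in> hom C (PO C V) Y.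
          im_cmp C V q (k \<cdot> a \<oplus>\<^bsub>V\<^esub> s \<cdot> y) = a"
    let ?W = "prd C K Y"
    note idW = idn_hom[OF p(3)]
    note r1 = real_im_hom[OF p(1)] and r2 = real_im_hom[OF p(2)]
    have Lhom: "?L \<in> hom C (PO C ?W) K"
      by (rule im_cmp_hom[OF p(3) im_real_cmp_hom[OF m ks] q])
    have pair_prjs: "pair C (real_im C ?p) (real_im C (prj2 C K Y)) = real_im C (idn C ?W)"
      by (rule prd_eqI[OF K Y pair_props(1)[OF r1 r2] real_im_hom[OF idW]])
        (simp_all only: pair_props(2,3)[OF r1 r2] cmp_real_im[OF idW p(1)]
          cmp_real_im[OF idW p(2)] cmp_idn_right[OF p(1)] cmp_idn_right[OF p(2)])
    have "im_cmp C ?W ?L (real_im C (idn C ?W)) = ?L"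
      by (simp only: im_cmp_real_im_right[OF idW Lhom] im_real_cmp_def[of C ?L] PA_idn[OF p(3)]
          cmp_idn_right[OF Lhom])
    then have "?L = im_cmp C ?W q (k \<cdot> real_im C ?p \<oplus>\<^bsub>?W\<^esub> s \<cdot> real_im C (prj2 C K Y))"
      by (simp only: precomp[OF p(3) r1 r2, symmetric] pair_prjs)
    also have "\<dots> = real_im C ?p"
      using * p(3) r1 r2 by blast
    finally show "?L = real_im C ?p" .
  qed
qed

text \<open>The first Schreier condition is this law at the identity of \<open>X\<close>, the universal generalized
  element; precomposing it with \<open>x\<close> gives the law at \<open>x\<close>.\<close>

lemma schreier_decomposition:
  assumes f: "f \<in> hom C X Y" and s: "s \<in> hom C Y X" and k: "k \<in> hom C K X"
    and q: "q \<in> hom C (PO C X) K"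
    and dec: "im_cmp C X (\<mu> X) (pair C (k \<cdot> q) (real_im C (s \<cdot> f))) = real_im C (idn C X)"
    and V: "V \<in> Ob C" and x: "x \<in> hom C (PO C V) X"
  shows "k \<cdot> im_cmp C V q x \<oplus>\<^bsub>V\<^esub> s \<cdot> (f \<cdot> x) = x"
proof -
  note X = homD(3)[OF f]
  note kq = cmp_hom[OF q k] and sf = cmp_hom[OF f s]
  have "k \<cdot> q \<oplus>\<^bsub>X\<^esub> real_im C (s \<cdot> f) = real_im C (idn C X)"
    using dec by (simp add: im_sum_def homD(2)[OF kq])
  then have "im_cmp C V (k \<cdot> q) x \<oplus>\<^bsub>V\<^esub> im_cmp C V (real_im C (s \<cdot> f)) x = x"
    using im_cmp_im_sum[OF V X x kq real_im_hom[OF sf]]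
      im_cmp_real_im_left[OF V x idn_hom[OF X]] cmp_idn_left[OF x] by simp
  then show ?thesis
    by (simp only: cmp_im_cmp[OF V x q k] im_cmp_real_im_left[OF V x sf] cmp_assoc[OF x f s])
qed

theorem intrinsic_schreier_split_ext_cmp:
  assumes assoc: "natural_addition_associative C"
    and F: "intrinsic_schreier_split_ext C K X Y k f s"
    and G: "intrinsic_schreier_split_ext C L Y Z l g v"
    and N: "is_kernel C (g \<cdot> f) N n"
  shows "intrinsic_schreier_split_ext C N X Z n (g \<cdot> f) (s \<cdot> v)"
proof -
  have f: "f \<in> hom C X Y" and s: "s \<in> hom C Y X" and fs: "f \<cdot> s = idn C Y"
    and kk: "is_kernel C f K k" using F by (auto simp: intrinsic_schreier_split_ext_def)
  have g: "g \<in> hom C Y Z" and v: "v \<in> hom C Z Y" and gv: "g \<cdot> v = idn C Z"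
    and ll: "is_kernel C g L l" using G by (auto simp: intrinsic_schreier_split_ext_def)
  note X = homD(3)[OF f] and Y = homD(3)[OF g] and Z = homD(4)[OF g]
  note gf = cmp_hom[OF f g] and sv = cmp_hom[OF v s]
  note k = kernel_props[OF kk f] and l = kernel_props[OF ll g] and n = kernel_props[OF N gf]
  note sl = cmp_hom[OF l(1) s]
  obtain q where q: "q \<in> hom C (PO C X) K"
    and q1: "\<And>V x. V \<in> Ob C \<Longrightarrow> x \<in> hom C (PO C V) X
      \<Longrightarrow> k \<cdot> im_cmp C V q x \<oplus>\<^bsub>V\<^esub> s \<cdot> (f \<cdot> x) = x"
    and q2: "\<And>V a y. V \<in> Ob C \<Longrightarrow> a \<in> hom C (PO C V) K \<Longrightarrow> y \<in> hom C (PO C V) Y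
      \<Longrightarrow> im_cmp C V q (k \<cdot> a \<oplus>\<^bsub>V\<^esub> s \<cdot> y) = a"
  proof -
    obtain q where q: "q \<in> hom C (PO C X) K"
      and dec: "im_cmp C X (\<mu> X) (pair C (k \<cdot> q) (real_im C (s \<cdot> f))) = real_im C (idn C X)"
      and ret: "im_cmp C (prd C K Y) q (im_real_cmp C (\<mu> X) (prod_arr C k s))
        = real_im C (prj1 C K Y)"
      using F unfolding intrinsic_schreier_split_ext_def im_hom_def by blast
    show thesis
      using that[OF q schreier_decomposition[OF f s k(1) q dec]]
        schreier_retraction_iff[OF k(1) s q] ret by blast
  qed
  obtain r where r: "r \<in> hom C (PO C Y) L"
    and r1: "\<And>V x. V \<in> Ob C \<Longrightarrow> x \<in> hom C (PO C V) Y
      \<Longrightarrow> l \<cdot> im_cmp C V r x \<oplus>\<^bsub>V\<^esub> v \<cdot> (g \<cdot> x) = x"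
    and r2: "\<And>V a y. V \<in> Ob C \<Longrightarrow> a \<in> hom C (PO C V) L \<Longrightarrow> y \<in> hom C (PO C V) Z
      \<Longrightarrow> im_cmp C V r (l \<cdot> a \<oplus>\<^bsub>V\<^esub> v \<cdot> y) = a"
  proof -
    obtain r where r: "r \<in> hom C (PO C Y) L"
      and dec: "im_cmp C Y (\<mu> Y) (pair C (l \<cdot> r) (real_im C (v \<cdot> g))) = real_im C (idn C Y)"
      and ret: "im_cmp C (prd C L Z) r (im_real_cmp C (\<mu> Y) (prod_arr C l v))
        = real_im C (prj1 C L Z)"
      using G unfolding intrinsic_schreier_split_ext_def im_hom_def by blast
    show thesis
      using that[OF r schreier_decomposition[OF g v l(1) r dec]]
        schreier_retraction_iff[OF l(1) v r] ret by blast
  qed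
  note rf = im_real_cmp_hom[OF r f]
  note kq = cmp_hom[OF q k(1)] and slrf = cmp_hom[OF rf sl]
  define m where "m = k \<cdot> q \<oplus>\<^bsub>X\<^esub> (s \<cdot> l) \<cdot> im_real_cmp C r f"
  have m: "m \<in> hom C (PO C X) X"
    unfolding m_def by (rule im_sum_hom[OF X kq slrf])
  have m_at: "im_cmp C V m x = k \<cdot> im_cmp C V q x \<oplus>\<^bsub>V\<^esub> s \<cdot> (l \<cdot> im_cmp C V r (f \<cdot> x))"
    if V: "V \<in> Ob C" and x: "x \<in> hom C (PO C V) X" for V x
    unfolding m_def
    using cmp_assoc[OF im_cmp_hom[OF V cmp_hom[OF x f] r] l(1) s]
    by (simp only: im_cmp_im_sum[OF V X x kq slrf] cmp_im_cmp[OF V x q k(1)]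
        cmp_im_cmp[OF V x rf sl] im_cmp_im_real_cmp[OF V x f r])
  have gfk: "(g \<cdot> f) \<cdot> k = zero_arr C K Z"
    using cmp_assoc[OF k(1) f g] k(2) cmp_zero_arr[OF g homD(3)[OF k(1)]] by simp
  have fsl: "f \<cdot> (s \<cdot> l) = l"
    using cmp_assoc[OF l(1) s f] fs cmp_idn_left[OF l(1)] by simp
  have gfsl: "(g \<cdot> f) \<cdot> (s \<cdot> l) = zero_arr C L Z"
    using cmp_assoc[OF sl f g] l(2) fsl by simp
  have "(g \<cdot> f) \<cdot> m = (g \<cdot> f) \<cdot> (k \<cdot> q) \<oplus>\<^bsub>X\<^esub> (g \<cdot> f) \<cdot> ((s \<cdot> l) \<cdot> im_real_cmp C r f)"
    unfolding m_def by (rule cmp_im_sum[OF X kq slrf gf])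
  also have "\<dots> = zero_arr C (PO C X) Z \<oplus>\<^bsub>X\<^esub> zero_arr C (PO C X) Z"
    by (simp only: cmp_assoc[OF q k(1) gf, symmetric] cmp_assoc[OF rf sl gf, symmetric]
        gfk gfsl zero_arr_cmp[OF q Z] zero_arr_cmp[OF rf Z])
  also have "\<dots> = zero_arr C (PO C X) Z"
    by (rule im_sum_zero_zero[OF X Z])
  finally obtain q' where q': "q' \<in> hom C (PO C X) N" and nq': "n \<cdot> q' = m"
    using n(3)[OF m] by blast
  \<comment> \<open>The first Schreier condition is \<open>m(x) + s v g f x = x\<close> at the generic element \<open>x = 1\<close>.\<close>
  have first: "im_cmp C X (\<mu> X) (pair C (n \<cdot> q') (real_im C ((s \<cdot> v) \<cdot> (g \<cdot> f))))
      = real_im C (idn C X)"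
  proof -
    let ?x = "real_im C (idn C X)"
    have x: "?x \<in> hom C (PO C X) X" by (rule real_im_hom[OF idn_hom[OF X]])
    note fx = cmp_hom[OF x f] note gfx = cmp_hom[OF fx g] note qx = im_cmp_hom[OF X x q]
    note rfx = im_cmp_hom[OF X fx r] note lrfx = cmp_hom[OF rfx l(1)] and vgfx = cmp_hom[OF gfx v]
    have mx: "im_cmp C X m ?x = m"
      using im_cmp_real_im_right[OF idn_hom[OF X] m] PA_idn[OF X] cmp_idn_right[OF m]
      by (simp add: im_real_cmp_def)
    have svgf: "real_im C ((s \<cdot> v) \<cdot> (g \<cdot> f)) = s \<cdot> (v \<cdot> (g \<cdot> (f \<cdot> ?x)))"
      using cmp_real_im[OF idn_hom[OF X] cmp_hom[OF gf sv]] cmp_idn_right[OF cmp_hom[OF gf sv]]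
        cmp_assoc[OF x gf sv] cmp_assoc[OF x f g] cmp_assoc[OF gfx v s] by simp
    have "im_cmp C X (\<mu> X) (pair C (n \<cdot> q') (real_im C ((s \<cdot> v) \<cdot> (g \<cdot> f))))
        = m \<oplus>\<^bsub>X\<^esub> s \<cdot> (v \<cdot> (g \<cdot> (f \<cdot> ?x)))"
      using homD(2)[OF m] by (simp add: im_sum_def nq' svgf)
    also have "\<dots> = (k \<cdot> im_cmp C X q ?x \<oplus>\<^bsub>X\<^esub> s \<cdot> (l \<cdot> im_cmp C X r (f \<cdot> ?x)))
        \<oplus>\<^bsub>X\<^esub> s \<cdot> (v \<cdot> (g \<cdot> (f \<cdot> ?x)))"
      using m_at[OF X x] mx by simp
    also have "\<dots> = k \<cdot> im_cmp C X q ?x \<oplus>\<^bsub>X\<^esub>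
        s \<cdot> (l \<cdot> im_cmp C X r (f \<cdot> ?x) \<oplus>\<^bsub>X\<^esub> v \<cdot> (g \<cdot> (f \<cdot> ?x)))"
      by (simp only: cmp_im_sum[OF X lrfx vgfx s] im_sum_assoc[OF assoc X cmp_hom[OF qx k(1)]
            cmp_hom[OF lrfx s] cmp_hom[OF vgfx s]])
    also have "\<dots> = ?x"
      by (simp only: r1[OF X fx] q1[OF X x])
    finally show ?thesis .
  qed
  \<comment> \<open>As \<open>g f n = 0\<close>, the map \<open>f\<close> restricts to \<open>b\<close> between the kernels of \<open>gf\<close> and \<open>g\<close>.\<close>
  obtain b where b: "b \<in> hom C N L" and lb: "l \<cdot> b = f \<cdot> n"
    using l(3)[OF cmp_hom[OF n(1) f]] n(2) cmp_assoc[OF n(1) f g] by auto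
  have "im_cmp C V q' (n \<cdot> c \<oplus>\<^bsub>V\<^esub> (s \<cdot> v) \<cdot> z) = c"
    if V: "V \<in> Ob C" and c: "c \<in> hom C (PO C V) N" and z: "z \<in> hom C (PO C V) Z" for V c z
  proof -
    note nc = cmp_hom[OF c n(1)] and vz = cmp_hom[OF z v] and bc = cmp_hom[OF c b]
    note fnc = cmp_hom[OF nc f] and svz = cmp_hom[OF z sv]
    note sfnc = cmp_hom[OF fnc s] and qnc = im_cmp_hom[OF V nc q]
    let ?w = "n \<cdot> c \<oplus>\<^bsub>V\<^esub> (s \<cdot> v) \<cdot> z"
    have w: "?w \<in> hom C (PO C V) X" by (rule im_sum_hom[OF V nc svz])
    have lbc: "f \<cdot> (n \<cdot> c) = l \<cdot> (b \<cdot> c)"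
      by (simp only: cmp_assoc[OF c n(1) f, symmetric] cmp_assoc[OF c b l(1), symmetric] lb)
    have svz': "(s \<cdot> v) \<cdot> z = s \<cdot> (v \<cdot> z)" by (rule cmp_assoc[OF z v s])
    have fsvz: "f \<cdot> ((s \<cdot> v) \<cdot> z) = v \<cdot> z"
      unfolding svz' using cmp_assoc[OF vz s f] fs cmp_idn_left[OF vz] by simp
    have fw: "f \<cdot> ?w = l \<cdot> (b \<cdot> c) \<oplus>\<^bsub>V\<^esub> v \<cdot> z"
      by (simp only: cmp_im_sum[OF V nc svz f] lbc fsvz)
    have rfw: "im_cmp C V r (f \<cdot> ?w) = b \<cdot> c"
      unfolding fw by (rule r2[OF V bc z])
    have "?w = (k \<cdot> im_cmp C V q (n \<cdot> c) \<oplus>\<^bsub>V\<^esub> s \<cdot> (f \<cdot> (n \<cdot> c))) \<oplus>\<^bsub>V\<^esub> s \<cdot> (v \<cdot> z)"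
      by (simp only: q1[OF V nc] svz')
    also have "\<dots> = k \<cdot> im_cmp C V q (n \<cdot> c) \<oplus>\<^bsub>V\<^esub> s \<cdot> (f \<cdot> (n \<cdot> c) \<oplus>\<^bsub>V\<^esub> v \<cdot> z)"
      by (simp only: im_sum_assoc[OF assoc V cmp_hom[OF qnc k(1)] sfnc cmp_hom[OF vz s]]
          cmp_im_sum[OF V fnc vz s])
    finally have qw: "im_cmp C V q ?w = im_cmp C V q (n \<cdot> c)"
      using q2[OF V qnc im_sum_hom[OF V fnc vz]] by simp
    have "n \<cdot> im_cmp C V q' ?w = im_cmp C V m ?w"
      using cmp_im_cmp[OF V w q' n(1)] nq' by simp
    also have "\<dots> = k \<cdot> im_cmp C V q (n \<cdot> c) \<oplus>\<^bsub>V\<^esub> s \<cdot> (f \<cdot> (n \<cdot> c))"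
      by (simp only: m_at[OF V w] qw rfw lbc)
    also have "\<dots> = n \<cdot> c" by (rule q1[OF V nc])
    finally show ?thesis
      by (rule n(4)[OF im_cmp_hom[OF V w q'] c])
  qed
  \<comment> \<open>Being a law on generalized elements, this is the second Schreier condition.\<close>
  then have second: "im_cmp C (prd C N Z) q' (im_real_cmp C (\<mu> X) (prod_arr C n (s \<cdot> v)))
      = real_im C (prj1 C N Z)"
    unfolding schreier_retraction_iff[OF n(1) sv q'] by blast
  have "(g \<cdot> f) \<cdot> (s \<cdot> v) = g \<cdot> ((f \<cdot> s) \<cdot> v)"
    by (simp only: cmp_assoc[OF sv f g] cmp_assoc[OF v s f])
  then have split: "(g \<cdot> f) \<cdot> (s \<cdot> v) = idn C Z"
    by (simp only: fs cmp_idn_left[OF v] gv)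
  show ?thesis
    unfolding intrinsic_schreier_split_ext_def im_hom_def
    using gf sv split N q' first second by blast
qed

end

theorem proposition7p1:
  fixes C :: "('o, 'a) imaginary_cat" (structure)
  assumes "regular_category C"
    and "unital_category C"
    and "binary_coproducts C"
    and "comonadic_covers C"
    and "natural_imaginary_splitting C"
    and "natural_addition_associative C"
    and "intrinsic_schreier_split_epi C X Y f s"
    and "intrinsic_schreier_split_epi C Y Z g v"
  shows "intrinsic_schreier_split_epi C X Z (g \<cdot> f) (s \<cdot> v)"
proof -
  interpret natural_imaginary_splitting C by fact
  obtain K k L l where F: "intrinsic_schreier_split_ext C K X Y k f s"
    and G: "intrinsic_schreier_split_ext C L Y Z l g v"
    using assms(7,8) unfolding intrinsic_schreier_split_epi_def by blast
  have "g \<cdot> f \<in> hom C X Z"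
    using F G cmp_hom unfolding intrinsic_schreier_split_ext_def by blast
  then obtain N n where "is_kernel C (g \<cdot> f) N n" by (rule kernel_ex)
  then show ?thesis
    using intrinsic_schreier_split_ext_cmp[OF assms(6) F G]
    unfolding intrinsic_schreier_split_epi_def by blast
qed

end
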